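(* Let $z$ be a positive integer. Then $z$ can be written as the sum of two nonzero squares of integers if and only if both of the following hold: (i) every prime factor $q$ of $z$ with $q\equiv 3\pmod 4$ has even exponent in the prime factorization of $z$; and (ii) if $z$ is a perfect square, then $z$ is divisible by some prime $p\equiv 1\pmod 4$. *)

theory Defs
  imports
    "HOL-Number_Theory.Number_Theory"
    "HOL-Computational_Algebra.Nth_Powers"
begin

end

theory Submission
  imports Defs "HOL-Library.Discrete_Functions"
begin

text \<open>
  The exponent condition is Fermat's two-square theorem: a prime \<open>q \<equiv> 3\<close> modulo 4 dividing
  \<open>a\<^sup>2 + b\<^sup>2\<close> divides both \<open>a\<close> and \<open>b\<close>, so it can be removed in pairs, while 2 and the primes
  \<open>p \<equiv> 1\<close> are sums of two squares (by Thue's pigeonhole argument applied to a square root of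
  \<open>-1\<close> modulo \<open>p\<close>) and such sums are closed under products. If \<open>z\<close> is not a square, neither
  summand can vanish. If \<open>z = n\<^sup>2\<close> has two nonzero summands, the primes 2 and \<open>q \<equiv> 3\<close> dividing \<open>n\<close>
  divide both of their roots and can be cancelled, so some prime \<open>p \<equiv> 1\<close> must divide \<open>n\<close>;
  conversely \<open>p = a\<^sup>2 + b\<^sup>2\<close> gives \<open>p\<^sup>2 = (a\<^sup>2 - b\<^sup>2)\<^sup>2 + (2ab)\<^sup>2\<close> with both summands nonzero.
\<close>

section \<open>Squares and Fermat's little theorem modulo a prime\<close>

lemma prime_neq_square_int:
  fixes p :: nat and a :: int
  assumes "prime p"
  shows "int p \<noteq> a\<^sup>2"
proof
  assume "int p = a\<^sup>2"
  then have "int p = int ((nat \<bar>a\<bar>)\<^sup>2)"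
    by simp
  then have "p = (nat \<bar>a\<bar>)\<^sup>2"
    by (simp only: of_nat_eq_iff)
  with assms show False
    by (simp add: prime_power_iff)
qed

text \<open>The exponent \<open>p - 1\<close> is even, so the sign of \<open>a\<close> is lost and
  Fermat's theorem for \<open>nat \<bar>a\<bar>\<close> suffices. Keeping \<open>a\<^sup>2\<close>
  as the base lets the result meet powers of \<open>- (b\<^sup>2)\<close>.\<close>

lemma fermat_theorem_int_even:
  fixes p k :: nat and a :: int
  assumes "prime p" "p - 1 = 2 * k" "\<not> int p dvd a"
  shows "[(a\<^sup>2) ^ k = 1] (mod int p)"
proof -
  have "\<not> p dvd nat \<bar>a\<bar>"
    using assms(3) by (metis int_dvd_int_iff dvd_abs_iff nat_0_le abs_ge_zero)
  then have "[nat \<bar>a\<bar> ^ (2 * k) = 1] (mod p)"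
    using fermat_theorem[OF assms(1)] assms(2) by metis
  then have "[int (nat \<bar>a\<bar> ^ (2 * k)) = int 1] (mod int p)"
    by (simp only: cong_int_iff)
  then show ?thesis
    by (simp add: power_mult)
qed

section \<open>Primes congruent to 3 modulo 4 in sums of two squares\<close>

text \<open>Otherwise \<open>q\<close> divides neither root; raising
  \<open>a\<^sup>2 = - (b\<^sup>2)\<close> modulo \<open>q\<close> to the odd power
  \<open>(q - 1) div 2\<close> gives \<open>1 = - 1\<close> by Fermat, forcing
  \<open>q \<le> 2\<close>.\<close>

lemma prime_3_mod_4_dvd_sum_squares:
  fixes q :: nat and a b :: int
  assumes "prime q" "q mod 4 = 3" "int q dvd a\<^sup>2 + b\<^sup>2"
  shows "int q dvd a"
proof (rule ccontr)
  assume na: "\<not> int q dvd a"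
  have pq: "prime (int q)"
    using assms(1) by simp
  have nb: "\<not> int q dvd b"
  proof
    assume "int q dvd b"
    then have "int q dvd a\<^sup>2"
      using assms(3) by (simp add: dvd_add_left_iff power2_eq_square)
    with pq na show False
      using prime_dvd_power by blast
  qed
  define k where "k = (q - 1) div 2"
  have k: "q - 1 = 2 * k" "odd k"
    using assms(2) unfolding k_def by presburger+
  have "[a\<^sup>2 = - (b\<^sup>2)] (mod int q)"
    using assms(3) by (simp add: cong_iff_dvd_diff)
  then have "[(a\<^sup>2) ^ k = (- (b\<^sup>2)) ^ k] (mod int q)"
    by (rule cong_pow)
  then have *: "[(a\<^sup>2) ^ k = - ((b\<^sup>2) ^ k)] (mod int q)"
    using k(2) by simp
  have "[- ((b\<^sup>2) ^ k) = - 1] (mod int q)"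
    using fermat_theorem_int_even[OF assms(1) k(1) nb] by (rule cong_uminus)
  then have "[1 = - 1] (mod int q)"
    using * fermat_theorem_int_even[OF assms(1) k(1) na] by (meson cong_trans cong_sym)
  then have "int q dvd 2"
    by (simp add: cong_iff_dvd_diff)
  then have "q \<le> 2"
    by (auto dest: zdvd_imp_le)
  with assms(2) show False
    by (cases "q = 0 \<or> q = 1 \<or> q = 2") auto
qed

lemma prime_3_mod_4_descent:
  fixes q n :: nat and a b :: int
  assumes "prime q" "q mod 4 = 3" "q dvd n" "int n = a\<^sup>2 + b\<^sup>2"
  obtains m c d where "n = q\<^sup>2 * m" "a = int q * c" "b = int q * d" "int m = c\<^sup>2 + d\<^sup>2"
proof -
  have "int q dvd a\<^sup>2 + b\<^sup>2"
    using assms(3,4) by (metis int_dvd_int_iff)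
  then have "int q dvd a" "int q dvd b"
    using prime_3_mod_4_dvd_sum_squares[OF assms(1,2), of a b]
      prime_3_mod_4_dvd_sum_squares[OF assms(1,2), of b a] by (simp_all add: add.commute)
  then obtain c d where cd: "a = int q * c" "b = int q * d"
    by (auto elim!: dvdE)
  have "int n = int (q\<^sup>2 * nat (c\<^sup>2 + d\<^sup>2))"
    using assms(4) cd by (simp add: algebra_simps power_mult_distrib)
  then have "n = q\<^sup>2 * nat (c\<^sup>2 + d\<^sup>2)"
    by (simp only: of_nat_eq_iff)
  with cd that[of "nat (c\<^sup>2 + d\<^sup>2)" c d] show ?thesis
    by simp
qed

text \<open>Descent: while \<open>q\<close> divides \<open>n\<close>, the cofactor of
  \<open>q\<^sup>2\<close> is a smaller sum of two squares, and the exponent has dropped by exactly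
  2.\<close>

lemma even_multiplicity_sum_squares:
  fixes q n :: nat and a b :: int
  assumes "prime q" "q mod 4 = 3" "n > 0" "int n = a\<^sup>2 + b\<^sup>2"
  shows "even (multiplicity q n)"
  using assms(3,4)
proof (induction n arbitrary: a b rule: less_induct)
  case (less n)
  show ?case
  proof (cases "q dvd n")
    case False
    then show ?thesis
      by (simp add: not_dvd_imp_multiplicity_0)
  next
    case True
    then obtain m c d where m: "n = q\<^sup>2 * m" "int m = c\<^sup>2 + d\<^sup>2"
      using prime_3_mod_4_descent[OF assms(1,2) True less.prems(2)] by metis
    have q: "q > 1" "q \<noteq> 0"
      using assms(1) prime_gt_1_nat by auto
    have "m > 0"
      using less.prems(1) m(1) by (cases m) auto
    moreover have "m < n"
      using \<open>m > 0\<close> q m(1) by (simp add: power2_eq_square one_less_mult)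
    ultimately have "even (multiplicity q m)"
      using less.IH m(2) by blast
    moreover have "multiplicity q n = 2 + multiplicity q m"
      using \<open>m > 0\<close> q assms(1) m(1)
      by (simp add: prime_elem_multiplicity_mult_distrib prime_elem_multiplicity_power_distrib)
    ultimately show ?thesis
      by simp
  qed
qed

section \<open>Primes congruent to 1 modulo 4 as sums of two squares\<close>

text \<open>Euler's criterion: \<open>(p - 1) div 2\<close> is even, so the Legendre symbol of
  \<open>- 1\<close> is 1 modulo \<open>p\<close>.\<close>

lemma prime_1_mod_4_minus_one_square:
  fixes p :: nat
  assumes "prime p" "p mod 4 = 1"
  obtains x :: int where "[x\<^sup>2 = - 1] (mod int p)"
proof -
  have p2: "p > 2"
    using assms prime_gt_1_nat[of p] by (cases "p = 2") auto
  have "even ((p - 1) div 2)"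
    using assms(2) by presburger
  then have leg: "[Legendre (- 1) (int p) = 1] (mod int p)"
    using euler_criterion[OF assms(1) p2, of "- 1"] by simp
  have "QuadRes (int p) (- 1)"
  proof (rule ccontr)
    assume "\<not> QuadRes (int p) (- 1)"
    then have "Legendre (- 1) (int p) = 0 \<or> Legendre (- 1) (int p) = - 1"
      by (simp add: Legendre_def)
    \<comment> \<open>The congruence settles the symbol itself, since its other values 0 and -1
      differ from 1 by 1 and 2.\<close>
    with leg have "int p dvd 1 \<or> int p dvd 2"
      by (auto simp: cong_iff_dvd_diff)
    then show False
      using p2 by (auto dest: zdvd_imp_le)
  qed
  with that show ?thesis
    by (auto simp: QuadRes_def)
qed

lemma prime_1_mod_4_sum_squares:
  fixes p :: nat
  assumes "prime p" "p mod 4 = 1"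
  obtains a b :: int where "int p = a\<^sup>2 + b\<^sup>2"
proof -
  obtain x :: int where x: "[x\<^sup>2 = - 1] (mod int p)"
    using prime_1_mod_4_minus_one_square assms by blast
  have p0: "p > 0"
    using assms(1) prime_gt_0_nat by blast
  define s where "s = floor_sqrt p"
  define A where "A = {0..int s} \<times> {0..int s}"
  define f where "f = (\<lambda>(u, v). (u - x * v) mod int p)"
  have "f ` A \<subseteq> {0..<int p}"
    using p0 by (auto simp: f_def)
  then have "card (f ` A) \<le> p"
    using card_mono[of "{0..<int p}" "f ` A"] by simp
  \<comment> \<open>Thue's count: the pairs with entries from 0 to \<open>s\<close> outnumber the
    residues modulo \<open>p\<close>.\<close>
  also have "p < (Suc s)\<^sup>2"
    unfolding s_def by (rule Suc_floor_sqrt_power2_gt)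
  also have "(Suc s)\<^sup>2 = card A"
    by (simp add: A_def card_cartesian_product power2_eq_square nat_add_distrib)
  finally have "\<not> inj_on f A"
    by (rule pigeonhole)
  then obtain u v u' v' where uv: "(u, v) \<in> A" "(u', v') \<in> A" "(u, v) \<noteq> (u', v')"
    and eq: "(u - x * v) mod int p = (u' - x * v') mod int p"
    by (auto simp: inj_on_def f_def)
  define a b where "a = u - u'" and "b = v - v'"
  \<comment> \<open>Strict because a prime is not a square; this keeps
    \<open>a\<^sup>2 + b\<^sup>2\<close> below \<open>2 * p\<close>, so that the multiple of
    \<open>p\<close> found below is \<open>p\<close> itself.\<close>
  have small: "c\<^sup>2 < int p" if "\<bar>c\<bar> \<le> int s" for c :: int
  proof -
    have "c\<^sup>2 \<le> (int s)\<^sup>2"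
      using that by (simp add: abs_le_square_iff[symmetric])
    also have "(int s)\<^sup>2 \<le> int p"
      unfolding s_def using floor_sqrt_power2_le[of p]
      by (metis of_nat_le_iff of_nat_power)
    finally show ?thesis
      using prime_neq_square_int[OF assms(1), of c] by simp
  qed
  have lt: "a\<^sup>2 < int p" "b\<^sup>2 < int p"
    using uv(1,2) by (auto intro!: small simp: A_def a_def b_def)
  have nz: "a\<^sup>2 + b\<^sup>2 > 0"
    using uv(3) by (auto simp: a_def b_def sum_power2_gt_zero_iff)
  have "int p dvd a - x * b"
    using eq by (simp add: a_def b_def mod_eq_dvd_iff algebra_simps)
  \<comment> \<open>The collision gives \<open>p\<close> dividing the first term, and the choice of
    \<open>x\<close> as a root of -1 gives the second.\<close>
  then have "int p dvd (a - x * b) * (a + x * b) + (x\<^sup>2 - - 1) * b\<^sup>2"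
    using x by (intro dvd_add dvd_mult2) (simp_all add: cong_iff_dvd_diff)
  also have "(a - x * b) * (a + x * b) + (x\<^sup>2 - - 1) * b\<^sup>2 = a\<^sup>2 + b\<^sup>2"
    by (simp add: algebra_simps power2_eq_square)
  finally obtain k where k: "a\<^sup>2 + b\<^sup>2 = int p * k"
    by (auto elim: dvdE)
  have "k > 0"
    using nz k p0 by (simp add: zero_less_mult_iff)
  moreover have "int p * k < int p * 2"
    using lt k by simp
  then have "k < 2"
    using p0 by simp
  ultimately have "k = 1"
    by simp
  with k that[of a b] show ?thesis
    by simp
qed

section \<open>Sufficiency in the two-square theorem\<close>

text \<open>Brahmagupta's identity: the norm of Gaussian integers is multiplicative.\<close>

lemma sum_squares_mult:
  fixes a b c d :: "'a :: comm_ring_1"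
  shows "(a\<^sup>2 + b\<^sup>2) * (c\<^sup>2 + d\<^sup>2) = (a * c - b * d)\<^sup>2 + (a * d + b * c)\<^sup>2"
  by (simp add: power2_eq_square algebra_simps)

lemma prime_nat_mod_4_cases:
  fixes p :: nat
  assumes "prime p"
  obtains "p = 2" | "p mod 4 = 1" | "p mod 4 = 3"
proof (cases "p = 2")
  case False
  then have "odd p"
    using assms prime_odd_nat[of p] prime_gt_1_nat[of p] by linarith
  then have "p mod 4 = 1 \<or> p mod 4 = 3"
    by presburger
  with that show ?thesis
    by blast
qed (use that in blast)

text \<open>Strong induction, splitting off \<open>p\<^sup>2\<close> when \<open>p\<close> is 3
  modulo 4 and a single \<open>p\<close> otherwise; both preserve the parity of every exponent in
  the hypothesis.\<close>

lemma sum_squares_of_even_multiplicity: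
  fixes n :: nat
  assumes "n > 0" "\<And>q. prime q \<Longrightarrow> q mod 4 = 3 \<Longrightarrow> even (multiplicity q n)"
  shows "\<exists>a b :: int. int n = a\<^sup>2 + b\<^sup>2"
  using assms
proof (induction n rule: less_induct)
  case (less n)
  show ?case
  proof (cases "n = 1")
    case True
    then have "int n = 1\<^sup>2 + 0\<^sup>2"
      by simp
    then show ?thesis
      by blast
  next
    case False
    then obtain p where p: "prime p" "p dvd n"
      using prime_factor_nat by blast
    have p1: "p > 1"
      using p(1) prime_gt_1_nat by blast
    show ?thesis
    proof (cases "p mod 4 = 3")
      case True
      have "multiplicity p n \<noteq> 0"
        using p less.prems(1) by (simp add: prime_elem_multiplicity_eq_zero_iff)
      moreover have "even (multiplicity p n)"
        using less.prems(2) p(1) True by blast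
      ultimately have "multiplicity p n \<ge> 2"
        by presburger
      then obtain m where m: "n = p\<^sup>2 * m"
        using multiplicity_dvd'[of 2 p n] by (auto elim: dvdE)
      have m0: "m > 0"
        using less.prems(1) m by (cases m) auto
      have "m < n"
        using m0 p1 m by (simp add: power2_eq_square one_less_mult)
      moreover have "even (multiplicity q m)" if "prime q" "q mod 4 = 3" for q
      proof -
        have "multiplicity q n = 2 * multiplicity q p + multiplicity q m"
          using that(1) m m0 p1
          by (simp add: prime_elem_multiplicity_mult_distrib prime_elem_multiplicity_power_distrib)
        with less.prems(2)[OF that] show ?thesis
          by simp
      qed
      ultimately obtain a b :: int where "int m = a\<^sup>2 + b\<^sup>2"
        using less.IH m0 by blast
      then have "int n = (int p * a)\<^sup>2 + (int p * b)\<^sup>2"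
        using m by (simp add: algebra_simps power_mult_distrib)
      then show ?thesis
        by blast
    next
      case False
      obtain m where m: "n = p * m"
        using p(2) by (auto elim: dvdE)
      have m0: "m > 0"
        using less.prems(1) m by (cases m) auto
      have "m < n"
        using m0 p1 m by simp
      moreover have "even (multiplicity q m)" if "prime q" "q mod 4 = 3" for q
      proof -
        have "multiplicity q p = 0"
          using prime_multiplicity_other that p(1) False by blast
        then have "multiplicity q n = multiplicity q m"
          using that(1) m m0 p1 by (simp add: prime_elem_multiplicity_mult_distrib)
        with less.prems(2)[OF that] show ?thesis
          by simp
      qed
      ultimately obtain a b :: int where ab: "int m = a\<^sup>2 + b\<^sup>2"
        using less.IH m0 by blast
      obtain c d :: int where cd: "int p = c\<^sup>2 + d\<^sup>2"
      proof (cases rule: prime_nat_mod_4_cases[OF p(1)])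
        case 1
        with that[of 1 1] show ?thesis
          by simp
      qed (use that False prime_1_mod_4_sum_squares[OF p(1)] in blast)+
      have "int n = (c * a - d * b)\<^sup>2 + (c * b + d * a)\<^sup>2"
        using m ab cd by (simp add: sum_squares_mult)
      then show ?thesis
        by blast
    qed
  qed
qed

section \<open>Squares as sums of two nonzero squares\<close>

text \<open>The roots have equal parity, and two odd squares sum to 2 modulo 4. This is the analogue
  at 2 of the divisibility for primes 3 modulo 4.\<close>

lemma even_even_if_4_dvd_sum_squares:
  fixes a b :: int
  assumes "4 dvd a\<^sup>2 + b\<^sup>2"
  shows "even a \<and> even b"
proof (rule ccontr)
  assume "\<not> (even a \<and> even b)"
  moreover have "even (a\<^sup>2 + b\<^sup>2)"
    using assms by (meson dvd_trans even_numeral)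
  ultimately have "odd a" "odd b"
    by auto
  then obtain c d where "a = 2 * c + 1" "b = 2 * d + 1"
    by (auto elim!: oddE)
  then have "a\<^sup>2 + b\<^sup>2 = 4 * (c\<^sup>2 + c + d\<^sup>2 + d) + 2"
    by (simp add: power2_eq_square algebra_simps)
  with assms show False
    by presburger
qed

lemma pythagorean_hypotenuse_prime_factor:
  fixes n :: nat and a b :: int
  assumes "(int n)\<^sup>2 = a\<^sup>2 + b\<^sup>2" "a \<noteq> 0" "b \<noteq> 0"
  shows "\<exists>p. prime p \<and> p mod 4 = 1 \<and> p dvd n"
  using assms
proof (induction n arbitrary: a b rule: less_induct)
  case (less n)
  have "a\<^sup>2 > 0" "b\<^sup>2 > 0"
    using less.prems by auto
  then have "(int n)\<^sup>2 > 1"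
    using less.prems(1) by linarith
  then have n: "n > 0" "n \<noteq> 1"
    by (auto intro: Nat.gr0I)
  then obtain p where p: "prime p" "p dvd n"
    using prime_factor_nat by blast
  have p1: "p > 1"
    using p(1) prime_gt_1_nat by blast
  obtain m where m: "n = p * m"
    using p(2) by (auto elim: dvdE)
  have "m < n"
    using p1 m n(1) by simp
  \<comment> \<open>Cancelling \<open>p\<^sup>2\<close> leaves the smaller hypotenuse
    \<open>m\<close> with both legs still nonzero, and a prime factor of \<open>m\<close> divides
    \<open>n\<close>.\<close>
  have *: ?case if dvd: "int p dvd a" "int p dvd b"
  proof -
    obtain c d where cd: "a = int p * c" "b = int p * d"
      using dvd by (auto elim!: dvdE)
    have "(int p)\<^sup>2 * (int m)\<^sup>2 = (int p)\<^sup>2 * (c\<^sup>2 + d\<^sup>2)"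
      using less.prems(1) m cd by (simp add: algebra_simps power_mult_distrib)
    then have "(int m)\<^sup>2 = c\<^sup>2 + d\<^sup>2"
      using p1 by (subst (asm) mult_left_cancel) auto
    then show ?thesis
      using less.IH[OF \<open>m < n\<close>, of c d] less.prems(2,3) cd m by auto
  qed
  show ?case
  proof (cases rule: prime_nat_mod_4_cases[OF p(1)])
    case 1
    have "4 dvd (int n)\<^sup>2"
      using m 1 by (simp add: power_mult_distrib)
    then show ?thesis
      using even_even_if_4_dvd_sum_squares[of a b] less.prems(1) 1 * by simp
  next
    case 2
    with p show ?thesis
      by blast
  next
    case 3
    have "int p dvd (int n)\<^sup>2"
      by (simp add: m power2_eq_square)
    then have "int p dvd a\<^sup>2 + b\<^sup>2" "int p dvd b\<^sup>2 + a\<^sup>2"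
      using less.prems(1) by (simp_all add: add.commute)
    with 3 show ?thesis
      using * prime_3_mod_4_dvd_sum_squares[OF p(1)] by blast
  qed
qed

lemma square_sum_nonzero_squares:
  fixes n p :: nat
  assumes "n > 0" "prime p" "p mod 4 = 1" "p dvd n"
  shows "\<exists>a b :: int. a \<noteq> 0 \<and> b \<noteq> 0 \<and> (int n)\<^sup>2 = a\<^sup>2 + b\<^sup>2"
proof -
  obtain m where m: "n = p * m"
    using assms(4) by (auto elim: dvdE)
  have m0: "m \<noteq> 0"
    using assms(1) m by (cases m) auto
  obtain a b :: int where ab: "int p = a\<^sup>2 + b\<^sup>2"
    using prime_1_mod_4_sum_squares assms by blast
  have "a \<noteq> 0" "b \<noteq> 0"
    using ab prime_neq_square_int[OF assms(2), of a] prime_neq_square_int[OF assms(2), of b] by auto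
  \<comment> \<open>Needed for the leg \<open>a\<^sup>2 - b\<^sup>2\<close> to be nonzero; equality
    would make \<open>p\<close> even.\<close>
  moreover have "a\<^sup>2 \<noteq> b\<^sup>2"
  proof
    assume "a\<^sup>2 = b\<^sup>2"
    with ab have "int p = 2 * b\<^sup>2"
      by simp
    then show False
      using assms(3) by presburger
  qed
  \<comment> \<open>The legs are \<open>m\<close> times the real and imaginary parts of the square
    of the Gaussian integer with coordinates \<open>a\<close> and \<open>b\<close>.\<close>
  moreover have "(int n)\<^sup>2 = (int m * (a\<^sup>2 - b\<^sup>2))\<^sup>2 + (int m * (2 * a * b))\<^sup>2"
    unfolding m of_nat_mult ab by (simp add: power2_eq_square algebra_simps)
  ultimately show ?thesis
    using m0 by (intro exI[of _ "int m * (a\<^sup>2 - b\<^sup>2)"] exI[of _ "int m * (2 * a * b)"]) auto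
qed

section \<open>The characterization, split by whether \<open>z\<close> is a square\<close>

theorem theorem1p8:
  fixes z :: nat
  assumes "z > 0"
  shows "(\<exists>a b :: int. a \<noteq> 0 \<and> b \<noteq> 0 \<and> int z = a\<^sup>2 + b\<^sup>2) \<longleftrightarrow>
    (\<forall>q \<in> prime_factors z. [q = 3] (mod 4) \<longrightarrow> even (multiplicity q z)) \<and>
    (is_square z \<longrightarrow> (\<exists>p. prime p \<and> [p = 1] (mod 4) \<and> p dvd z))"
  (is "?L \<longleftrightarrow> ?R1 \<and> ?R2")
proof
  assume ?L
  then obtain a b :: int where ab: "a \<noteq> 0" "b \<noteq> 0" "int z = a\<^sup>2 + b\<^sup>2"
    by blast
  have ?R1
    using even_multiplicity_sum_squares[OF _ _ assms ab(3)]
    by (auto simp: cong_def in_prime_factors_iff)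
  moreover have ?R2
  proof
    assume "is_square z"
    then obtain n where n: "z = n\<^sup>2"
      by (auto elim: is_nth_powerE)
    then have "\<exists>p. prime p \<and> p mod 4 = 1 \<and> p dvd n"
      using pythagorean_hypotenuse_prime_factor[of n a b] ab by simp
    then show "\<exists>p. prime p \<and> [p = 1] (mod 4) \<and> p dvd z"
      using n by (auto simp: cong_def power2_eq_square)
  qed
  ultimately show "?R1 \<and> ?R2"
    by blast
next
  assume R: "?R1 \<and> ?R2"
  show ?L
  proof (cases "is_square z")
    case True
    then obtain n where n: "z = n\<^sup>2"
      by (auto elim: is_nth_powerE)
    obtain p where p: "prime p" "p mod 4 = 1" "p dvd z"
      using R True by (auto simp: cong_def)
    then have "p dvd n"
      using n prime_dvd_power by blast
    then show ?thesis
      using square_sum_nonzero_squares[of n p] p n assms by simp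
  next
    case False
    have "even (multiplicity q z)" if "prime q" "q mod 4 = 3" for q
    \<comment> \<open>The assumption speaks only of prime factors of \<open>z\<close>; any other
      prime has exponent 0, which is even.\<close>
    proof (cases "q dvd z")
      case True
      with R that assms show ?thesis
        by (simp add: cong_def in_prime_factors_iff)
    qed (simp add: not_dvd_imp_multiplicity_0)
    then obtain a b :: int where ab: "int z = a\<^sup>2 + b\<^sup>2"
      using sum_squares_of_even_multiplicity assms by blast
    have "int z \<noteq> c\<^sup>2" for c :: int
    proof
      assume "int z = c\<^sup>2"
      then have "int z = int ((nat \<bar>c\<bar>)\<^sup>2)"
        by simp
      then have "z = (nat \<bar>c\<bar>)\<^sup>2"
        by (simp only: of_nat_eq_iff)
      with False show False
        by auto
    qed
    with ab have "a \<noteq> 0" "b \<noteq> 0"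
      by force+
    with ab show ?thesis
      by blast
  qed
qed

end
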